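(* Let $\mathfrak g$ be a real solvable Lie algebra of dimension $2n>4$ with abelian nilradical $\mathfrak h$ of codimension $2$. Assume that $\mathfrak g$ is endowed with an SKT structure $(J,\langle\cdot,\cdot\rangle)$ such that $J\mathfrak h=\mathfrak h$. If there exists another complex structure $I$ on $\mathfrak g$ compatible with $\langle\cdot,\cdot\rangle$ and such that $I\mathfrak h\neq\mathfrak h$, then $(J,\langle\cdot,\cdot\rangle)$ is Kähler. In particular, $\mathfrak g$ does not admit any non-Kähler generalized Kähler structure $(I,J,\langle\cdot,\cdot\rangle)$ such that $I\mathfrak h\neq\mathfrak h$ and $J\mathfrak h=\mathfrak h$.
   Context: All Lie algebras are real and finite-dimensional. The nilradical is the maximal nilpotent ideal. A complex structure on $\mathfrak g$ is $J\in\mathrm{End}(\mathfrak g)$ with $J^2=-\mathrm{Id}$ and $[X,Y]+J([JX,Y]+[X,JY])-[JX,JY]=0$ for all $X,Y$; it is compatible with an inner product $\langle\cdot,\cdot\rangle$ if $\langle JX,JY\rangle=\langle X,Y\rangle$, and then $(J,\langle\cdot,\cdot\rangle)$ is a Hermitian structure with fundamental form $\omega=\langle J\cdot,\cdot\rangle$. $d$ is the Chevalley–Eilenberg differential. Bismut torsion: $c(X,Y,Z)=d\omega(JX,JY,JZ)$. The structure is SKT if $dc=0$ and Kähler if $d\omega=0$. A generalized Kähler structure $(I,J,\langle\cdot,\cdot\rangle)$ is a pair of Hermitian structures $(I,\langle\cdot,\cdot\rangle)$, $(J,\langle\cdot,\cdot\rangle)$ with Bismut torsions $c_I=-c_J$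 and $dc_I=0$. It is non-Kähler if the common torsion $c_I=-c_J$ is nonzero (equivalently, neither of the two Hermitian structures is Kähler). *)

theory Defs
  imports "HOL-Analysis.Analysis"
begin

text \<open>
  A Lie algebra is a bracket on a type of class \<open>euclidean_space\<close>. The class serves only to
  provide a finite-dimensional real vector space: the metrics below are arbitrary
  positive definite symmetric bilinear forms, unrelated to the inner product of the class.
\<close>

definition lie_algebra :: "('a::euclidean_space \<Rightarrow> 'a \<Rightarrow> 'a) \<Rightarrow> bool" where
  "lie_algebra br \<longleftrightarrow>
     bilinear br \<and> (\<forall>x. br x x = 0) \<and>
     (\<forall>x y z. br x (br y z) + br y (br z x) + br z (br x y) = 0)"

definition lie_product ::
    "('a::euclidean_space \<Rightarrow> 'a \<Rightarrow> 'a) \<Rightarrow> 'a set \<Rightarrow> 'a set \<Rightarrow> 'a set" where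
  "lie_product br A B = span {br x y | x y. x \<in> A \<and> y \<in> B}"

primrec derived_series :: "('a::euclidean_space \<Rightarrow> 'a \<Rightarrow> 'a) \<Rightarrow> nat \<Rightarrow> 'a set" where
  "derived_series br 0 = UNIV"
| "derived_series br (Suc k) = lie_product br (derived_series br k) (derived_series br k)"

definition lie_solvable :: "('a::euclidean_space \<Rightarrow> 'a \<Rightarrow> 'a) \<Rightarrow> bool" where
  "lie_solvable br \<longleftrightarrow> (\<exists>k. derived_series br k = {0})"

definition lie_ideal :: "('a::euclidean_space \<Rightarrow> 'a \<Rightarrow> 'a) \<Rightarrow> 'a set \<Rightarrow> bool" where
  "lie_ideal br \<aa> \<longleftrightarrow> subspace \<aa> \<and> (\<forall>x. \<forall>y\<in>\<aa>. br x y \<in> \<aa>)"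

primrec lower_central_series ::
    "('a::euclidean_space \<Rightarrow> 'a \<Rightarrow> 'a) \<Rightarrow> 'a set \<Rightarrow> nat \<Rightarrow> 'a set" where
  "lower_central_series br \<aa> 0 = \<aa>"
| "lower_central_series br \<aa> (Suc k) = lie_product br \<aa> (lower_central_series br \<aa> k)"

definition nilpotent_ideal :: "('a::euclidean_space \<Rightarrow> 'a \<Rightarrow> 'a) \<Rightarrow> 'a set \<Rightarrow> bool" where
  "nilpotent_ideal br \<aa> \<longleftrightarrow>
     lie_ideal br \<aa> \<and> (\<exists>k. lower_central_series br \<aa> k = {0})"

definition is_nilradical :: "('a::euclidean_space \<Rightarrow> 'a \<Rightarrow> 'a) \<Rightarrow> 'a set \<Rightarrow> bool" where
  "is_nilradical br \<hh> \<longleftrightarrow>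
     nilpotent_ideal br \<hh> \<and> (\<forall>\<aa>. nilpotent_ideal br \<aa> \<longrightarrow> \<aa> \<subseteq> \<hh>)"

definition lie_abelian :: "('a::euclidean_space \<Rightarrow> 'a \<Rightarrow> 'a) \<Rightarrow> 'a set \<Rightarrow> bool" where
  "lie_abelian br \<aa> \<longleftrightarrow> (\<forall>x\<in>\<aa>. \<forall>y\<in>\<aa>. br x y = 0)"

definition inner_product :: "('a::euclidean_space \<Rightarrow> 'a \<Rightarrow> real) \<Rightarrow> bool" where
  "inner_product g \<longleftrightarrow>
     bilinear g \<and> (\<forall>x y. g x y = g y x) \<and> (\<forall>x. x \<noteq> 0 \<longrightarrow> g x x > 0)"

definition complex_structure ::
    "('a::euclidean_space \<Rightarrow> 'a \<Rightarrow> 'a) \<Rightarrow> ('a \<Rightarrow> 'a) \<Rightarrow> bool" where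
  "complex_structure br J \<longleftrightarrow>
     linear J \<and> (\<forall>x. J (J x) = - x) \<and>
     (\<forall>x y. br x y + J (br (J x) y + br x (J y)) - br (J x) (J y) = 0)"

definition compatible ::
    "('a::euclidean_space \<Rightarrow> 'a \<Rightarrow> real) \<Rightarrow> ('a \<Rightarrow> 'a) \<Rightarrow> bool" where
  "compatible g J \<longleftrightarrow> (\<forall>x y. g (J x) (J y) = g x y)"

definition hermitian_structure ::
    "('a::euclidean_space \<Rightarrow> 'a \<Rightarrow> 'a) \<Rightarrow> ('a \<Rightarrow> 'a) \<Rightarrow> ('a \<Rightarrow> 'a \<Rightarrow> real) \<Rightarrow> bool" where
  "hermitian_structure br J g \<longleftrightarrow>
     inner_product g \<and> complex_structure br J \<and> compatible g J"

definition fundamental_form ::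
    "('a::euclidean_space \<Rightarrow> 'a) \<Rightarrow> ('a \<Rightarrow> 'a \<Rightarrow> real) \<Rightarrow> 'a \<Rightarrow> 'a \<Rightarrow> real" where
  "fundamental_form J g x y = g (J x) y"

text \<open>
  The Chevalley--Eilenberg differential
  \<open>d\<alpha>(x\<^sub>0,\<dots>,x\<^sub>k) = \<Sum>i<j. (-1)\<^sup>i\<^sup>+\<^sup>j \<alpha>([x\<^sub>i,x\<^sub>j],x\<^sub>0,\<dots>)\<close>, with \<open>x\<^sub>i\<close> and \<open>x\<^sub>j\<close> omitted
  from the trailing arguments, written out for \<open>k = 2\<close> and \<open>k = 3\<close>.
\<close>

definition ce_diff2 ::
    "('a::euclidean_space \<Rightarrow> 'a \<Rightarrow> 'a) \<Rightarrow> ('a \<Rightarrow> 'a \<Rightarrow> real) \<Rightarrow> 'a \<Rightarrow> 'a \<Rightarrow> 'a \<Rightarrow> real" where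
  "ce_diff2 br \<alpha> x y z = - \<alpha> (br x y) z + \<alpha> (br x z) y - \<alpha> (br y z) x"

definition ce_diff3 ::
    "('a::euclidean_space \<Rightarrow> 'a \<Rightarrow> 'a) \<Rightarrow> ('a \<Rightarrow> 'a \<Rightarrow> 'a \<Rightarrow> real) \<Rightarrow>
     'a \<Rightarrow> 'a \<Rightarrow> 'a \<Rightarrow> 'a \<Rightarrow> real" where
  "ce_diff3 br \<alpha> x y z w =
     - \<alpha> (br x y) z w + \<alpha> (br x z) y w - \<alpha> (br x w) y z
     - \<alpha> (br y z) x w + \<alpha> (br y w) x z - \<alpha> (br z w) x y"

definition bismut_torsion ::
    "('a::euclidean_space \<Rightarrow> 'a \<Rightarrow> 'a) \<Rightarrow> ('a \<Rightarrow> 'a) \<Rightarrow> ('a \<Rightarrow> 'a \<Rightarrow> real) \<Rightarrow>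
     'a \<Rightarrow> 'a \<Rightarrow> 'a \<Rightarrow> real" where
  "bismut_torsion br J g x y z = ce_diff2 br (fundamental_form J g) (J x) (J y) (J z)"

definition skt_structure ::
    "('a::euclidean_space \<Rightarrow> 'a \<Rightarrow> 'a) \<Rightarrow> ('a \<Rightarrow> 'a) \<Rightarrow> ('a \<Rightarrow> 'a \<Rightarrow> real) \<Rightarrow> bool" where
  "skt_structure br J g \<longleftrightarrow>
     hermitian_structure br J g \<and>
     (\<forall>x y z w. ce_diff3 br (bismut_torsion br J g) x y z w = 0)"

definition kaehler_structure ::
    "('a::euclidean_space \<Rightarrow> 'a \<Rightarrow> 'a) \<Rightarrow> ('a \<Rightarrow> 'a) \<Rightarrow> ('a \<Rightarrow> 'a \<Rightarrow> real) \<Rightarrow> bool" where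
  "kaehler_structure br J g \<longleftrightarrow>
     hermitian_structure br J g \<and>
     (\<forall>x y z. ce_diff2 br (fundamental_form J g) x y z = 0)"

definition generalized_kaehler ::
    "('a::euclidean_space \<Rightarrow> 'a \<Rightarrow> 'a) \<Rightarrow> ('a \<Rightarrow> 'a) \<Rightarrow> ('a \<Rightarrow> 'a) \<Rightarrow>
     ('a \<Rightarrow> 'a \<Rightarrow> real) \<Rightarrow> bool" where
  "generalized_kaehler br I J g \<longleftrightarrow>
     hermitian_structure br I g \<and> hermitian_structure br J g \<and>
     (\<forall>x y z. bismut_torsion br I g x y z = - bismut_torsion br J g x y z) \<and>
     (\<forall>x y z w. ce_diff3 br (bismut_torsion br I g) x y z w = 0)"

definition non_kaehler_generalized_kaehler ::
    "('a::euclidean_space \<Rightarrow> 'a \<Rightarrow> 'a) \<Rightarrow> ('a \<Rightarrow> 'a) \<Rightarrow> ('a \<Rightarrow> 'a) \<Rightarrow>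
     ('a \<Rightarrow> 'a \<Rightarrow> real) \<Rightarrow> bool" where
  "non_kaehler_generalized_kaehler br I J g \<longleftrightarrow>
     generalized_kaehler br I J g \<and> (\<exists>x y z. bismut_torsion br I g x y z \<noteq> 0)"

end

theory Submission
  imports Defs
begin

text \<open>
  Let \<open>e\<close> be a unit vector orthogonal to \<open>\<hh>\<close> and \<open>f = J e\<close>. As \<open>J\<close> is orthogonal and preserves \<open>\<hh>\<close>,
  the orthogonal complement of \<open>\<hh>\<close> is spanned by \<open>e\<close> and \<open>f\<close>. Since \<open>\<hh>\<close> is abelian, the bracket
  consists of the two operators \<open>A = ad e\<close> and \<open>B = ad f\<close> on \<open>\<hh>\<close> and of the vector \<open>[e, f]\<close>.

  The vector \<open>[e, f]\<close> lies in \<open>\<hh>\<close> (\<open>commutator_in_nilradical\<close>). Otherwise there are \<open>E\<close>, \<open>F\<close> outside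
  \<open>\<hh>\<close> with \<open>[E, F] = F\<close> modulo \<open>\<hh>\<close>; then \<open>ad F\<close> is nilpotent on \<open>\<hh>\<close>, and \<open>\<real>F + \<hh>\<close> is a nilpotent
  ideal larger than the nilradical. In particular \<open>A\<close> and \<open>B\<close> commute.

  The SKT equation, evaluated on \<open>(e, f, b, J b)\<close> and summed over an orthonormal basis of \<open>\<hh>\<close>, says
  that \<open>|M - M\<^sup>T|\<^sup>2 + |N - N\<^sup>T|\<^sup>2 = 0\<close> for \<open>M = J A\<close>, \<open>N = J B\<close>. So \<open>A\<close> and \<open>B\<close> are infinitesimally
  symplectic for \<open>\<omega>\<close> (\<open>skt_imp_symplectic_action\<close>). This kills every component of \<open>d\<omega>\<close> except
  \<open>d\<omega>(e, f, x) = - \<omega>([e, f], x)\<close>, so the structure is Kaehler as soon as \<open>[e, f] = 0\<close>.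
  Integrability of \<open>J\<close> and \<open>A B = B A\<close> improve symplectic to unitary: \<open>A\<close> and \<open>B\<close> commute with \<open>J\<close> and
  are skew (\<open>skt_imp_unitary_action\<close>).

  It remains to use \<open>I\<close>. Because \<open>I\<close> moves \<open>\<hh>\<close>, the parts \<open>u\<close>, \<open>w\<close> in \<open>\<hh>\<close> of \<open>I e\<close>, \<open>I f\<close> are nonzero,
  orthogonal and of the same length, and \<open>\<hh> \<inter> I \<hh>\<close> is their orthogonal complement in \<open>\<hh>\<close>. Integrability
  of \<open>I\<close> shows that \<open>A\<close> and \<open>B\<close> preserve \<open>\<hh> \<inter> I \<hh>\<close>; being skew, they also preserve the plane spanned by
  \<open>u\<close> and \<open>w\<close>, on which they are multiples \<open>a\<close>, \<open>b\<close> of one rotation. Integrability on the pair \<open>(u, w)\<close>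
  then reads \<open>[e, f] = - (a e + b f)\<close>. The left side is in \<open>\<hh>\<close> and the right side is orthogonal to \<open>\<hh>\<close>, so
  both vanish (\<open>transverse_complex_structure_imp_commuting\<close>).

  In a generalized Kaehler structure \<open>c\<^sub>J = - c\<^sub>I\<close> is closed too, so \<open>J\<close> is SKT, hence Kaehler, and the
  torsion vanishes.
\<close>

section \<open>Orthonormal bases and traces\<close>

locale positive_form =
  fixes g :: "'a::euclidean_space \<Rightarrow> 'a \<Rightarrow> real"
  assumes inner_product_g: "inner_product g"
begin

lemma bilinear_g: "bilinear g" and g_sym: "g x y = g y x"
  using inner_product_g by (auto simp: inner_product_def)

lemmas g_simps = bilinear_ladd[OF bilinear_g] bilinear_radd[OF bilinear_g]
  bilinear_lmul[OF bilinear_g] bilinear_rmul[OF bilinear_g]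
  bilinear_lneg[OF bilinear_g] bilinear_rneg[OF bilinear_g]
  bilinear_lsub[OF bilinear_g] bilinear_rsub[OF bilinear_g]
  bilinear_lzero[OF bilinear_g] bilinear_rzero[OF bilinear_g]

lemma linear_g: "linear (g x)" "linear (\<lambda>x. g x y)"
  using bilinear_g by (auto simp: bilinear_def)

lemma g_self_eq_0: "g x x = 0 \<longleftrightarrow> x = 0"
  using inner_product_g g_simps(9) unfolding inner_product_def by (metis less_irrefl)

lemma g_self_nonneg: "0 \<le> g x x"
  using inner_product_g g_self_eq_0 unfolding inner_product_def by (metis order.refl less_imp_le)

lemma g_self_pos: "x \<noteq> 0 \<Longrightarrow> 0 < g x x"
  using g_self_eq_0 g_self_nonneg by (metis order_less_le)

definition orthonormal :: "'a set \<Rightarrow> bool" where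
  "orthonormal B \<longleftrightarrow> finite B \<and> (\<forall>b\<in>B. \<forall>c\<in>B. g b c = (if b = c then 1 else 0))"

lemma orthonormal_coeff:
  assumes "orthonormal B" "c \<in> B"
  shows "g (\<Sum>b\<in>B. r b *\<^sub>R b) c = r c"
proof -
  have "g (\<Sum>b\<in>B. r b *\<^sub>R b) c = (\<Sum>b\<in>B. g (r b *\<^sub>R b) c)"
    by (rule linear_sum[OF linear_g(2)])
  also have "\<dots> = (\<Sum>b\<in>B. if b = c then r b else 0)"
    using assms by (intro sum.cong) (auto simp: orthonormal_def g_simps)
  also have "\<dots> = r c"
    using assms by (simp add: orthonormal_def)
  finally show ?thesis .
qed

lemma orthonormal_expansion:
  assumes B: "orthonormal B" and x: "x \<in> span B"
  shows "x = (\<Sum>b\<in>B. g x b *\<^sub>R b)"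
proof -
  have "finite B" using B by (simp add: orthonormal_def)
  then obtain r where r: "x = (\<Sum>b\<in>B. r b *\<^sub>R b)"
    using x span_finite by auto
  have "g x b = r b" if "b \<in> B" for b
    using orthonormal_coeff[OF B that] r by simp
  then show ?thesis using r by simp
qed

lemma orthonormal_independent:
  assumes B: "orthonormal B"
  shows "independent B"
proof (rule independent_if_scalars_zero)
  show "finite B" using B by (simp add: orthonormal_def)
  fix r b assume "(\<Sum>x\<in>B. r x *\<^sub>R x) = 0" "b \<in> B"
  then show "r b = 0"
    using orthonormal_coeff[OF B, of b r] g_simps(9) by simp
qed

lemma orthonormal_insert:
  assumes "orthonormal B" "g e e = 1" "\<And>b. b \<in> B \<Longrightarrow> g e b = 0"
  shows "orthonormal (insert e B)" "e \<notin> B"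
proof -
  have "g b e = 0" if "b \<in> B" for b
    using assms(3)[OF that] g_sym[of b e] by simp
  then show "orthonormal (insert e B)" "e \<notin> B"
    using assms by (auto simp: orthonormal_def)
qed

text \<open>One step of Gram--Schmidt.\<close>

lemma unit_normal_vector:
  assumes B: "orthonormal B" and S: "subspace S" "B \<subseteq> S" and x: "x \<in> S" "x \<notin> span B"
  obtains e where "e \<in> S" "g e e = 1" "\<And>y. y \<in> span B \<Longrightarrow> g e y = 0"
proof -
  let ?p = "\<Sum>b\<in>B. g x b *\<^sub>R b"
  define z where "z = x - ?p"
  have p: "?p \<in> span B" by (intro span_sum span_scale span_base)
  then have "z \<noteq> 0" using x by (auto simp: z_def)
  then have pos: "0 < g z z" by (rule g_self_pos)
  have "?p \<in> S" using S by (intro subspace_sum subspace_scale) auto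
  then have zS: "z \<in> S" using S x by (simp add: z_def subspace_diff)
  have zB: "g z b = 0" if "b \<in> B" for b
    using orthonormal_coeff[OF B that] by (simp add: z_def g_simps)
  have zspan: "g z y = 0" if "y \<in> span B" for y
    using linear_eq_0_on_span[OF linear_g(1)[of z] zB that] .
  show ?thesis
  proof (rule that[of "(1 / sqrt (g z z)) *\<^sub>R z"])
    show "(1 / sqrt (g z z)) *\<^sub>R z \<in> S" using zS S by (simp add: subspace_scale)
    show "g ((1 / sqrt (g z z)) *\<^sub>R z) ((1 / sqrt (g z z)) *\<^sub>R z) = 1"
      using pos by (simp add: g_simps)
    show "g ((1 / sqrt (g z z)) *\<^sub>R z) y = 0" if "y \<in> span B" for y
      using zspan[OF that] by (simp add: g_simps)
  qed
qed

lemma orthonormal_basis_exists: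
  assumes S: "subspace S"
  obtains B where "orthonormal B" "span B = S"
proof -
  let ?P = "\<lambda>B. orthonormal B \<and> B \<subseteq> S"
  have bound: "card B < Suc DIM('a)" if "?P B" for B
    using independent_bound[OF orthonormal_independent] that by force
  have "?P {}" by (simp add: orthonormal_def)
  then obtain B where B: "?P B" and max: "\<And>C. ?P C \<Longrightarrow> card C \<le> card B"
    using ex_has_greatest_nat[of ?P "{}" card "Suc DIM('a)"] bound by (metis less_imp_le)
  have "S \<subseteq> span B"
  proof (rule ccontr)
    assume "\<not> S \<subseteq> span B"
    then obtain x where "x \<in> S" "x \<notin> span B" by blast
    then obtain e where e: "e \<in> S" "g e e = 1" "\<And>y. y \<in> span B \<Longrightarrow> g e y = 0"
      using unit_normal_vector B S by blast
    then have "orthonormal (insert e B)" "e \<notin> B"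
      using orthonormal_insert[of B e] B span_base by blast+
    then show False
      using max[of "insert e B"] B e by (simp add: orthonormal_def)
  qed
  moreover have "span B \<subseteq> S" using B S by (simp add: span_minimal)
  ultimately show ?thesis using that B by blast
qed

end

locale orthonormal_frame = positive_form g
  for g :: "'a::euclidean_space \<Rightarrow> 'a \<Rightarrow> real" +
  fixes \<hh> B :: "'a set"
  assumes orthonormal_B: "orthonormal B" and span_B: "span B = \<hh>"
begin

lemma subspace_h: "subspace \<hh>"
  using span_B by (metis subspace_span)

lemma B_in_h: "b \<in> B \<Longrightarrow> b \<in> \<hh>"
  using span_B span_base by blast

lemma h_closed:
  "0 \<in> \<hh>" "x \<in> \<hh> \<Longrightarrow> y \<in> \<hh> \<Longrightarrow> x + y \<in> \<hh>" "x \<in> \<hh> \<Longrightarrow> y \<in> \<hh> \<Longrightarrow> x - y \<in> \<hh>"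
  "x \<in> \<hh> \<Longrightarrow> - x \<in> \<hh>" "x \<in> \<hh> \<Longrightarrow> r *\<^sub>R x \<in> \<hh>"
  using subspace_h by (auto simp: subspace_def intro: subspace_neg subspace_diff)

definition endo :: "('a \<Rightarrow> 'a) \<Rightarrow> bool" where
  "endo f \<longleftrightarrow> linear f \<and> (\<forall>x\<in>\<hh>. f x \<in> \<hh>)"

definition tr :: "('a \<Rightarrow> 'a) \<Rightarrow> real" where
  "tr f = (\<Sum>b\<in>B. g (f b) b)"

lemma endoD: "endo f \<Longrightarrow> x \<in> \<hh> \<Longrightarrow> f x \<in> \<hh>"
  by (simp add: endo_def)

lemma endo_comp: "endo f \<Longrightarrow> endo k \<Longrightarrow> endo (\<lambda>x. f (k x))"
  by (auto simp: endo_def linear_compose[of k f, unfolded comp_def])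

lemma expand_left:
  assumes Q: "\<And>y. linear (\<lambda>x. Q x y)" and x: "x \<in> \<hh>"
  shows "Q x y = (\<Sum>c\<in>B. g x c * (Q c y :: real))"
proof -
  have "Q x y = Q (\<Sum>c\<in>B. g x c *\<^sub>R c) y"
    using orthonormal_expansion[OF orthonormal_B] x span_B by simp
  also have "\<dots> = (\<Sum>c\<in>B. Q (g x c *\<^sub>R c) y)"
    by (rule linear_sum[OF Q])
  finally show ?thesis by (simp add: linear_scale[OF Q])
qed

lemma tr_comm:
  assumes f: "endo f" and k: "endo k"
  shows "tr (\<lambda>x. f (k x)) = tr (\<lambda>x. k (f x))"
proof -
  have lin: "linear (\<lambda>x. g (f x) y)" "linear (\<lambda>x. g (k x) y)" for y
    using f k linear_compose[OF _ linear_g(2), unfolded comp_def] by (auto simp: endo_def)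
  have "tr (\<lambda>x. f (k x)) = (\<Sum>b\<in>B. \<Sum>c\<in>B. g (k b) c * g (f c) b)"
    unfolding tr_def using k B_in_h
    by (intro sum.cong[OF refl] expand_left[of "\<lambda>x. g (f x)"] lin) (auto simp: endo_def)
  also have "\<dots> = (\<Sum>c\<in>B. \<Sum>b\<in>B. g (f c) b * g (k b) c)"
    by (subst sum.swap) (simp add: mult.commute)
  also have "\<dots> = tr (\<lambda>x. k (f x))"
    unfolding tr_def using f B_in_h
    by (intro sum.cong[OF refl] expand_left[of "\<lambda>x. g (k x)", symmetric] lin) (auto simp: endo_def)
  finally show ?thesis .
qed

text \<open>
  The trace of a bilinear form with respect to \<open>g\<close> does not depend on the orthonormal basis, and
  \<open>J b\<close> runs through an orthonormal basis when \<open>b\<close> does; the skewness of \<open>J\<close> gives a computation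
  that avoids changing the basis.
\<close>

lemma trace_form_invariant:
  fixes Q :: "'a \<Rightarrow> 'a \<Rightarrow> real"
  assumes Q: "bilinear Q" and J: "endo J"
    and skew: "\<And>x y. g (J x) y = - g x (J y)" and JJ: "\<And>x. J (J x) = - x"
  shows "(\<Sum>b\<in>B. Q (J b) (J b)) = (\<Sum>b\<in>B. Q b b)"
proof -
  have lin: "linear (\<lambda>x. Q x y)" "linear (Q x)" for x y
    using Q by (auto simp: bilinear_def)
  have linJ: "linear (\<lambda>y. Q x (J y))" for x
    using J linear_compose[OF _ lin(2), unfolded comp_def] by (auto simp: endo_def)
  have "(\<Sum>b\<in>B. Q (J b) (J b)) = (\<Sum>b\<in>B. \<Sum>c\<in>B. g (J b) c * Q c (J b))"
    using J B_in_h by (intro sum.cong[OF refl] expand_left lin) (auto simp: endo_def)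
  also have "\<dots> = (\<Sum>c\<in>B. \<Sum>b\<in>B. g (J b) c * Q c (J b))"
    by (rule sum.swap)
  also have "\<dots> = (\<Sum>c\<in>B. \<Sum>b\<in>B. - (g (J c) b * Q c (J b)))"
  proof (intro sum.cong[OF refl])
    fix b c
    have "g (J b) c = - g (J c) b" using skew[of b c] g_sym[of b "J c"] by simp
    then show "g (J b) c * Q c (J b) = - (g (J c) b * Q c (J b))" by simp
  qed
  also have "\<dots> = (\<Sum>c\<in>B. - Q c (J (J c)))"
    using J B_in_h unfolding sum_negf
    by (intro sum.cong[OF refl] arg_cong[of _ _ uminus]
        expand_left[of "\<lambda>y x. Q x (J y)", symmetric] linJ) (auto simp: endo_def)
  also have "\<dots> = (\<Sum>b\<in>B. Q b b)"
    by (simp add: JJ bilinear_rneg[OF Q])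
  finally show ?thesis .
qed

text \<open>
  In matrix terms, \<open>tr (M\<^sup>T M) - tr (M M) = |M - M\<^sup>T|\<^sup>2 / 2\<close>. This turns the vanishing of a trace
  into the symmetry of \<open>M\<close>.
\<close>

lemma sum_square_defect:
  assumes M: "endo M"
  shows "(\<Sum>b\<in>B. g (M b) (M b)) - tr (\<lambda>x. M (M x)) =
    (\<Sum>b\<in>B. \<Sum>c\<in>B. (g (M b) c - g (M c) b)\<^sup>2) / 2"
proof -
  have lin: "linear (\<lambda>x. g (M x) y)" for y
    using M linear_compose[OF _ linear_g(2), unfolded comp_def] by (auto simp: endo_def)
  have 1: "(\<Sum>b\<in>B. g (M b) (M b)) = (\<Sum>b\<in>B. \<Sum>c\<in>B. (g (M b) c)\<^sup>2)"
  proof (rule sum.cong[OF refl])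
    fix b assume "b \<in> B"
    then have "M b \<in> \<hh>" using M B_in_h by (simp add: endo_def)
    from expand_left[of g, OF linear_g(2) this]
    have "g (M b) (M b) = (\<Sum>c\<in>B. g (M b) c * g c (M b))" .
    also have "\<dots> = (\<Sum>c\<in>B. (g (M b) c)\<^sup>2)"
      by (rule sum.cong) (simp_all only: power2_eq_square g_sym)
    finally show "g (M b) (M b) = (\<Sum>c\<in>B. (g (M b) c)\<^sup>2)" .
  qed
  have 2: "tr (\<lambda>x. M (M x)) = (\<Sum>b\<in>B. \<Sum>c\<in>B. g (M b) c * g (M c) b)"
    unfolding tr_def using M B_in_h
    by (intro sum.cong[OF refl] expand_left[of "\<lambda>x. g (M x)"] lin) (auto simp: endo_def)
  have 3: "(\<Sum>b\<in>B. \<Sum>c\<in>B. (g (M c) b)\<^sup>2) = (\<Sum>b\<in>B. \<Sum>c\<in>B. (g (M b) c)\<^sup>2)"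
    by (rule sum.swap)
  have "(\<Sum>b\<in>B. \<Sum>c\<in>B. (g (M b) c - g (M c) b)\<^sup>2) =
      (\<Sum>b\<in>B. \<Sum>c\<in>B. (g (M b) c)\<^sup>2) + (\<Sum>b\<in>B. \<Sum>c\<in>B. (g (M c) b)\<^sup>2)
      - 2 * (\<Sum>b\<in>B. \<Sum>c\<in>B. g (M b) c * g (M c) b)"
    by (simp add: power2_diff sum.distrib sum_subtractf sum_distrib_left mult.assoc)
  then show ?thesis using 1 2 3 by simp
qed

lemma symmetric_if_no_defect:
  assumes M: "endo M" and zero: "\<And>b c. b \<in> B \<Longrightarrow> c \<in> B \<Longrightarrow> g (M b) c = g (M c) b"
    and "x \<in> \<hh>" "y \<in> \<hh>"
  shows "g (M x) y = g x (M y)"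
proof -
  let ?Q = "\<lambda>x y. g (M x) y - g x (M y)"
  have lin: "linear M" using M by (simp add: endo_def)
  have "bilinear ?Q" "bilinear (\<lambda>x y. 0 :: real)"
    unfolding bilinear_def
    by (auto intro!: linearI simp: linear_add[OF lin] linear_scale[OF lin] g_simps algebra_simps)
  then have "?Q x y = 0"
    by (rule bilinear_eq[where S=\<hh> and T=\<hh> and B=B and C=B])
      (use assms span_B g_sym in \<open>auto simp: subset_iff\<close>)
  then show ?thesis by simp
qed

end

section \<open>The commutator ideal lies in the nilradical\<close>

lemma linear_funpow:
  fixes f :: "'a::real_vector \<Rightarrow> 'a"
  assumes "linear f"
  shows "linear (f ^^ k)"
proof (induction k)
  case 0
  show ?case using linear_id by (simp add: id_def)
next
  case (Suc k)
  show ?case using linear_compose[OF Suc assms] by (simp add: comp_def)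
qed

text \<open>
  From \<open>[D, N] = N\<close> follows \<open>[D, N\<^sup>k] = k N\<^sup>k\<close>, so \<open>k \<parallel>N\<^sup>k\<parallel> \<le> 2 \<parallel>D\<parallel> \<parallel>N\<^sup>k\<parallel>\<close>. Once \<open>k\<close> exceeds \<open>2 \<parallel>D\<parallel>\<close>
  this forces \<open>N\<^sup>k = 0\<close>.
\<close>

lemma commutator_fixed_nilpotent:
  fixes D N :: "'a::euclidean_space \<Rightarrow> 'a"
  assumes D: "linear D" and N: "linear N" and comm: "\<And>x. D (N x) - N (D x) = N x"
  obtains k where "0 < k" "\<And>x. (N ^^ k) x = 0"
proof -
  note lin = linear_funpow[OF N]
  have DN: "D ((N ^^ k) x) - (N ^^ k) (D x) = real k *\<^sub>R (N ^^ k) x" for k x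
  proof (induction k)
    case (Suc k)
    have "D ((N ^^ Suc k) x) = N (D ((N ^^ k) x)) + N ((N ^^ k) x)"
      using comm[of "(N ^^ k) x"] by (simp add: algebra_simps)
    also have "D ((N ^^ k) x) = (N ^^ k) (D x) + real k *\<^sub>R (N ^^ k) x"
      using Suc by (simp add: algebra_simps)
    finally show ?case
      by (simp add: linear_add[OF N] linear_scale[OF N] algebra_simps)
  qed simp
  obtain k :: nat where k: "2 * onorm D < real k" using reals_Archimedean2 by blast
  let ?T = "N ^^ k"
  have bD: "bounded_linear D" and bT: "bounded_linear ?T"
    using D lin by (auto simp: linear_conv_bounded_linear)
  have k0: "0 < real k" using k onorm_pos_le[OF bD] by linarith
  have "norm (?T x) \<le> (2 * onorm D * onorm ?T / real k) * norm x" for x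
  proof -
    have "real k * norm (?T x) = norm (D (?T x) - ?T (D x))"
      by (simp add: DN)
    also have "\<dots> \<le> norm (D (?T x)) + norm (?T (D x))" by (rule norm_triangle_ineq4)
    also have "norm (D (?T x)) \<le> onorm D * (onorm ?T * norm x)"
      using onorm[OF bD, of "?T x"] onorm[OF bT, of x] onorm_pos_le[OF bD]
      by (meson mult_left_mono order_trans)
    also have "norm (?T (D x)) \<le> onorm ?T * (onorm D * norm x)"
      using onorm[OF bT, of "D x"] onorm[OF bD, of x] onorm_pos_le[OF bT]
      by (meson mult_left_mono order_trans)
    finally show ?thesis using k0 by (simp add: field_simps)
  qed
  then have "onorm ?T \<le> 2 * onorm D * onorm ?T / real k" by (rule onorm_le)
  then have "(real k - 2 * onorm D) * onorm ?T \<le> 0" using k0 by (simp add: field_simps)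
  then have "onorm ?T = 0"
    using k onorm_pos_le[OF bT] by (simp add: mult_le_0_iff)
  then have "?T x = 0" for x using onorm_eq_0[OF bT] by simp
  then show ?thesis using that k0 by simp
qed

locale lie_bracket =
  fixes br :: "'a::euclidean_space \<Rightarrow> 'a \<Rightarrow> 'a"
  assumes lie: "lie_algebra br"
begin

lemma bilinear_br: "bilinear br" and br_self: "br x x = 0"
  and jacobi: "br x (br y z) + br y (br z x) + br z (br x y) = 0"
  using lie by (auto simp: lie_algebra_def)

lemmas br_simps = bilinear_ladd[OF bilinear_br] bilinear_radd[OF bilinear_br]
  bilinear_lmul[OF bilinear_br] bilinear_rmul[OF bilinear_br]
  bilinear_lneg[OF bilinear_br] bilinear_rneg[OF bilinear_br]
  bilinear_lsub[OF bilinear_br] bilinear_rsub[OF bilinear_br]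
  bilinear_lzero[OF bilinear_br] bilinear_rzero[OF bilinear_br]

lemma linear_br: "linear (br x)"
  using bilinear_br by (auto simp: bilinear_def)

lemma br_anti: "br y x = - br x y"
proof -
  have "br x x + br y x + (br x y + br y y) = 0"
    using br_self[of "x + y"] by (simp only: br_simps)
  then show ?thesis by (simp add: br_self add_eq_0_iff2)
qed

lemma br_commutator: "br x (br y z) - br y (br x z) = br (br x y) z"
  using jacobi[of x y z] br_anti[of x z] br_anti[of z "br x y"] by (simp add: br_simps algebra_simps)

text \<open>
  On the abelian ideal \<open>\<hh>\<close> the relation \<open>[E, F] = F\<close> modulo \<open>\<hh>\<close> becomes \<open>[ad E, ad F] = ad F\<close>, so \<open>ad F\<close> is
  nilpotent there. Hence \<open>\<real>F + \<hh>\<close>, which is an ideal because it contains all brackets, is nilpotent,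
  and the maximality of the nilradical gives \<open>F \<in> \<hh>\<close>.
\<close>

lemma mem_abelian_nilradical:
  assumes nil: "is_nilradical br \<hh>" and ab: "lie_abelian br \<hh>"
    and F: "\<And>x y. \<exists>t. br x y - t *\<^sub>R F \<in> \<hh>" and EF: "br E F - F \<in> \<hh>"
  shows "F \<in> \<hh>"
proof -
  have sub: "subspace \<hh>" and ideal: "y \<in> \<hh> \<Longrightarrow> br x y \<in> \<hh>" for x y
    using nil by (auto simp: is_nilradical_def nilpotent_ideal_def lie_ideal_def)
  interpret dot: positive_form "inner :: 'a \<Rightarrow> 'a \<Rightarrow> real"
    by unfold_locales (auto simp: inner_product_def bilinear_conv_bounded_bilinear
        bounded_bilinear_inner inner_commute)
  (* Any linear projection onto the ideal serves to extend the two operators to the whole space,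
     where the relation between them still holds exactly, not just modulo the ideal. *)
  obtain B where B: "dot.orthonormal B" "span B = \<hh>"
    using dot.orthonormal_basis_exists[OF sub] .
  define P where "P x = (\<Sum>b\<in>B. (x \<bullet> b) *\<^sub>R b)" for x
  have linP: "linear P"
    unfolding P_def by (intro linear_compose_sum ballI linearI) (auto simp: inner_simps scaleR_add_left)
  have PB: "P x \<in> \<hh>" for x
    unfolding P_def B(2)[symmetric] by (intro span_sum span_scale span_base)
  have Pid: "x \<in> \<hh> \<Longrightarrow> P x = x" for x
    using dot.orthonormal_expansion[OF B(1), of x] B(2) unfolding P_def by simp
  define N where "N x = br F (P x)" for x
  define D where "D x = br E (P x)" for x
  have NF: "N x = br F x" if "x \<in> \<hh>" for x using that by (simp add: N_def Pid)
  have Nh: "N x \<in> \<hh>" for x using ideal PB by (simp add: N_def)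
  have Dh: "D x \<in> \<hh>" for x using ideal PB by (simp add: D_def)
  have linN: "linear N" and linD: "linear D"
    using linear_compose[OF linP linear_br] by (auto simp: N_def[abs_def] D_def[abs_def] comp_def)
  have "D (N x) - N (D x) = N x" for x
  proof -
    have "D (N x) - N (D x) = br (br E F) (P x)"
      using Nh[of x] Dh[of x] by (simp add: D_def N_def Pid PB ideal br_commutator)
    also have "\<dots> = br F (P x) + br (br E F - F) (P x)" by (simp add: br_simps)
    also have "br (br E F - F) (P x) = 0" using ab EF PB by (auto simp: lie_abelian_def)
    finally show ?thesis by (simp add: N_def)
  qed
  then obtain k where k: "0 < k" "\<And>x. (N ^^ k) x = 0"
    using commutator_fixed_nilpotent[OF linD linN] by blast
  define \<aa> where "\<aa> = {t *\<^sub>R F + y | t y. y \<in> \<hh>}"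
  have hS: "0 \<in> \<hh>" "x \<in> \<hh> \<Longrightarrow> y \<in> \<hh> \<Longrightarrow> x + y \<in> \<hh>" "x \<in> \<hh> \<Longrightarrow> r *\<^sub>R x \<in> \<hh>"
    "x \<in> \<hh> \<Longrightarrow> y \<in> \<hh> \<Longrightarrow> x - y \<in> \<hh>" for x y r
    using sub by (auto simp: subspace_def intro: subspace_diff)
  have "subspace \<aa>"
  proof (rule subspaceI)
    have "0 = 0 *\<^sub>R F + 0" by simp
    then show "0 \<in> \<aa>" unfolding \<aa>_def using hS(1) by blast
    fix x y assume "x \<in> \<aa>" "y \<in> \<aa>"
    then obtain s t x' y' where *: "x = s *\<^sub>R F + x'" "y = t *\<^sub>R F + y'" "x' \<in> \<hh>" "y' \<in> \<hh>"
      unfolding \<aa>_def by blast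
    then have "x + y = (s + t) *\<^sub>R F + (x' + y')" by (simp add: algebra_simps)
    then show "x + y \<in> \<aa>" unfolding \<aa>_def using * hS(2) by blast
  next
    fix c x assume "x \<in> \<aa>"
    then obtain s x' where *: "x = s *\<^sub>R F + x'" "x' \<in> \<hh>" unfolding \<aa>_def by blast
    then have "c *\<^sub>R x = (c * s) *\<^sub>R F + c *\<^sub>R x'" by (simp add: algebra_simps)
    then show "c *\<^sub>R x \<in> \<aa>" unfolding \<aa>_def using * hS(3) by blast
  qed
  moreover have "br x y \<in> \<aa>" for x y
  proof -
    obtain t where "br x y - t *\<^sub>R F \<in> \<hh>" using F by blast
    moreover have "br x y = t *\<^sub>R F + (br x y - t *\<^sub>R F)" by simp
    ultimately show ?thesis unfolding \<aa>_def by blast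
  qed
  ultimately have ideal_a: "lie_ideal br \<aa>" by (simp add: lie_ideal_def)
  have brN: "br (t *\<^sub>R F + x) y = t *\<^sub>R N y" if "x \<in> \<hh>" "y \<in> \<hh>" for t x y
    using that ab by (simp add: br_simps NF lie_abelian_def)
  note linNk = linear_funpow[OF linN]
  have lcs: "lower_central_series br \<aa> (Suc j) \<subseteq> (N ^^ Suc j) ` \<hh>" for j
  proof (induction j)
    case 0
    have "br x y \<in> N ` \<hh>" if xy: "x \<in> \<aa>" "y \<in> \<aa>" for x y
    proof -
      obtain s t x' y' where *: "x = s *\<^sub>R F + x'" "y = t *\<^sub>R F + y'" "x' \<in> \<hh>" "y' \<in> \<hh>"
        using xy unfolding \<aa>_def by blast
      have "br x y = br (s *\<^sub>R F + x') y' - t *\<^sub>R br F x'"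
        by (simp add: * br_simps br_self br_anti[of F x'])
      also have "\<dots> = N (s *\<^sub>R y' - t *\<^sub>R x')"
        using * by (simp add: brN NF linear_diff[OF linN] linear_scale[OF linN])
      finally show ?thesis using *(3,4) by (auto intro!: imageI hS(3,4))
    qed
    moreover have "subspace (N ` \<hh>)" using linear_subspace_image[OF linN sub] .
    ultimately have "lie_product br \<aa> \<aa> \<subseteq> N ` \<hh>"
      unfolding lie_product_def by (intro span_minimal) blast+
    then show ?case by simp
  next
    case (Suc j)
    have "br x y \<in> (N ^^ Suc (Suc j)) ` \<hh>" if x: "x \<in> \<aa>" and y: "y \<in> (N ^^ Suc j) ` \<hh>" for x y
    proof -
      obtain s x' where *: "x = s *\<^sub>R F + x'" "x' \<in> \<hh>" using x unfolding \<aa>_def by blast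
      obtain z where z: "z \<in> \<hh>" "y = (N ^^ Suc j) z" using y by blast
      have "y \<in> \<hh>" using z Nh by simp
      then have "br x y = (N ^^ Suc (Suc j)) (s *\<^sub>R z)"
        using * z by (simp add: brN linear_scale[OF linN] linear_scale[OF linNk])
      then show ?thesis using hS(3)[OF z(1)] by (metis imageI)
    qed
    moreover have "subspace ((N ^^ Suc (Suc j)) ` \<hh>)" using linear_subspace_image[OF linNk sub] .
    ultimately show ?case using Suc
      unfolding lower_central_series.simps(2)[of br \<aa> "Suc j"] lie_product_def
      by (intro span_minimal) blast+
  qed
  have "lower_central_series br \<aa> k \<subseteq> {0}" using lcs[of "k - 1"] k by auto
  moreover have "0 \<in> lower_central_series br \<aa> k"
    using k(1) by (cases k) (auto simp: lie_product_def span_zero)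
  ultimately have "lower_central_series br \<aa> k = {0}" by blast
  then have "nilpotent_ideal br \<aa>" using ideal_a by (auto simp: nilpotent_ideal_def)
  then have "\<aa> \<subseteq> \<hh>" using nil by (simp add: is_nilradical_def)
  moreover have "F = 1 *\<^sub>R F + 0" by simp
  then have "F \<in> \<aa>" unfolding \<aa>_def using hS(1) by blast
  ultimately show ?thesis by blast
qed

end


section \<open>Commuting families compatible with a complex structure\<close>

context orthonormal_frame
begin

lemma tr_cong: "(\<And>x. x \<in> \<hh> \<Longrightarrow> f x = k x) \<Longrightarrow> tr f = tr k"
  unfolding tr_def using B_in_h by (auto intro!: sum.cong)

lemma tr_add: "tr (\<lambda>x. f x + k x) = tr f + tr k"
  and tr_minus: "tr (\<lambda>x. - f x) = - tr f"
  by (simp_all add: tr_def g_simps sum.distrib sum_negf)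

lemma symmetric_trace_square_0:
  assumes L: "endo L" and sym: "\<And>x y. x \<in> \<hh> \<Longrightarrow> y \<in> \<hh> \<Longrightarrow> g (L x) y = g x (L y)"
    and tr0: "tr (\<lambda>x. L (L x)) = 0" and x: "x \<in> \<hh>"
  shows "L x = 0"
proof -
  have "(\<Sum>b\<in>B. g (L b) (L b)) = 0"
    using tr0 sym[OF endoD[OF L]] B_in_h unfolding tr_def by (simp cong: sum.cong)
  then have "\<forall>b\<in>B. g (L b) (L b) = 0"
    using orthonormal_B by (simp add: sum_nonneg_eq_0_iff g_self_nonneg orthonormal_def)
  then have "\<And>b. b \<in> B \<Longrightarrow> L b = 0" by (simp add: g_self_eq_0)
  moreover have "linear L" using L by (simp add: endo_def)
  ultimately show ?thesis using linear_eq_0_on_span[of L B x] x span_B by simp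
qed

text \<open>
  Let \<open>S\<^sub>a\<close>, \<open>T\<^sub>a\<close> be the parts of \<open>S\<close>, \<open>T\<close> that anticommute with \<open>J\<close>. The integrability condition relates
  them by \<open>S\<^sub>a = - J T\<^sub>a\<close>, and \<open>L = 2 S\<^sub>a\<close> is symmetric because \<open>J S\<close> is. Expanding one factor of
  \<open>L\<^sup>2\<close> through \<open>S\<close> and the other through \<open>T\<close> gives \<open>tr (L\<^sup>2) = 2 tr ([S, T] J) = 0\<close>, so \<open>L = 0\<close>.
\<close>

lemma commuting_with_complex_structure:
  assumes endo: "endo S" "endo T" "endo J"
    and J_skew: "\<And>x y. g (J x) y = - g x (J y)" and JJ: "\<And>x. J (J x) = - x"
    and symS: "\<And>x y. x \<in> \<hh> \<Longrightarrow> y \<in> \<hh> \<Longrightarrow> g (J (S x)) y = g x (J (S y))"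
    and ST: "\<And>x. x \<in> \<hh> \<Longrightarrow> S (T x) = T (S x)"
    and int: "\<And>x. x \<in> \<hh> \<Longrightarrow> S x + J (T x) + J (S (J x)) - T (J x) = 0"
    and x: "x \<in> \<hh>"
  shows "S (J x) = J (S x)" "T (J x) = J (T x)"
proof -
  have lin: "linear S" "linear T" "linear J" using endo by (auto simp: endo_def)
  note lins = linear_add[OF lin(1)] linear_add[OF lin(2)] linear_add[OF lin(3)]
    linear_diff[OF lin(1)] linear_diff[OF lin(2)] linear_diff[OF lin(3)]
    linear_neg[OF lin(1)] linear_neg[OF lin(2)] linear_neg[OF lin(3)]
  define L where "L x = S x + J (S (J x))" for x
  have L: "endo L"
    unfolding endo_def
  proof
    show "linear L" unfolding L_def
      by (intro linearI) (simp_all add: lins linear_scale[OF lin(1)] linear_scale[OF lin(3)] scaleR_add_right)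
    show "\<forall>x\<in>\<hh>. L x \<in> \<hh>" using endo by (simp add: L_def endo_def h_closed)
  qed
  have L_eq: "L y = T (J y) - J (T y)" if "y \<in> \<hh>" for y
    using int[OF that] by (simp add: L_def algebra_simps)
  have sym: "g (L x) y = g x (L y)" if xy: "x \<in> \<hh>" "y \<in> \<hh>" for x y
  proof -
    have "g (J (S (J x))) y = g (J x) (J (S y))"
      using symS[of "J x" y] xy endo by (simp add: endo_def)
    also have "\<dots> = g x (S y)" using J_skew[of x "J (S y)"] by (simp add: JJ g_simps)
    finally have 1: "g (J (S (J x))) y = g x (S y)" .
    have "g x (J (S (J y))) = g (J (S x)) (J y)"
      using symS[of x "J y"] xy endo by (simp add: endo_def)
    also have "\<dots> = g (S x) y" using J_skew[of "S x" "J y"] by (simp add: JJ g_simps)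
    finally show ?thesis using 1 by (simp add: L_def g_simps)
  qed
  have STJ: "endo (\<lambda>x. S (J x))" "endo (\<lambda>x. S (T x))"
      "endo (\<lambda>x. S (J (T (J x))))"
    using endo_comp[OF endo(1,3)] endo_comp[OF endo(1,2)]
      endo_comp[OF endo(1) endo_comp[OF endo(3) endo_comp[OF endo(2,3)]]] .
  have 1: "tr (\<lambda>x. S (J (T x))) = tr (\<lambda>x. S (T (J x)))"
  proof -
    have "tr (\<lambda>x. S (J (T x))) = tr (\<lambda>x. T (S (J x)))" by (rule tr_comm[OF STJ(1) endo(2)])
    also have "\<dots> = tr (\<lambda>x. S (T (J x)))" using ST endo by (intro tr_cong) (simp add: endo_def)
    finally show ?thesis .
  qed
  have 2: "tr (\<lambda>x. J (S (T x))) = tr (\<lambda>x. S (T (J x)))"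
    by (rule tr_comm[OF endo(3) STJ(2)])
  have 3: "tr (\<lambda>x. J (S (J (T (J x))))) = - tr (\<lambda>x. S (J (T x)))"
    using tr_comm[OF endo(3) STJ(3)] by (simp add: JJ lins tr_minus)
  have "tr (\<lambda>x. L (L x)) =
      tr (\<lambda>x. (S (T (J x)) + J (S (T x))) + (- S (J (T x)) + J (S (J (T (J x))))))"
  proof (rule tr_cong)
    fix x assume x: "x \<in> \<hh>"
    show "L (L x) = (S (T (J x)) + J (S (T x))) + (- S (J (T x)) + J (S (J (T (J x)))))"
      unfolding L_def[of "L x"] by (simp add: L_eq[OF x] lins JJ algebra_simps)
  qed
  also have "\<dots> = 0" unfolding tr_add tr_minus 1 2 3 by simp
  finally have "tr (\<lambda>x. L (L x)) = 0" .
  then have "L x = 0" using symmetric_trace_square_0[OF L] sym x by blast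
  then have 0: "S x + J (S (J x)) = 0" "T (J x) = J (T x)"
    using L_eq[OF x] by (simp_all add: L_def)
  have "J (S x + J (S (J x))) = 0" using 0 linear_0[OF lin(3)] by simp
  then show "S (J x) = J (S x)" by (simp add: lins JJ)
  show "T (J x) = J (T x)" by (rule 0)
qed

end

section \<open>Hermitian structures preserving an abelian ideal of codimension two\<close>

locale hermitian_abelian_ideal = lie_bracket br + orthonormal_frame g \<hh> B
  for br :: "'a::euclidean_space \<Rightarrow> 'a \<Rightarrow> 'a" and g :: "'a \<Rightarrow> 'a \<Rightarrow> real" and \<hh> B +
  fixes J :: "'a \<Rightarrow> 'a" and e :: 'a
  assumes complex_J: "complex_structure br J" and compatible_J: "compatible g J"
    and ideal: "y \<in> \<hh> \<Longrightarrow> br x y \<in> \<hh>"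
    and abelian: "x \<in> \<hh> \<Longrightarrow> y \<in> \<hh> \<Longrightarrow> br x y = 0"
    and J_h: "x \<in> \<hh> \<Longrightarrow> J x \<in> \<hh>"
    and e_unit: "g e e = 1" and e_perp: "y \<in> \<hh> \<Longrightarrow> g e y = 0"
    and split: "x - g x e *\<^sub>R e - g x (J e) *\<^sub>R J e \<in> \<hh>"
begin

abbreviation f :: 'a where "f \<equiv> J e"

lemma linear_J: "linear J" and JJ: "J (J x) = - x"
  and integrable_J: "br x y + J (br (J x) y + br x (J y)) - br (J x) (J y) = 0"
  using complex_J by (auto simp: complex_structure_def)

lemmas J_simps = linear_add[OF linear_J] linear_diff[OF linear_J] linear_neg[OF linear_J]
  linear_scale[OF linear_J] linear_0[OF linear_J] JJ

lemma J_orth: "g (J x) (J y) = g x y"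
  using compatible_J by (simp add: compatible_def)

lemma J_skew: "g (J x) y = - g x (J y)"
  using J_orth[of x "J y"] by (simp add: JJ g_simps)

lemma f_perp: "y \<in> \<hh> \<Longrightarrow> g f y = 0"
  using J_skew[of e y] e_perp[OF J_h] by simp

lemma perp: "y \<in> \<hh> \<Longrightarrow> g e y = 0" "y \<in> \<hh> \<Longrightarrow> g y e = 0"
  "y \<in> \<hh> \<Longrightarrow> g f y = 0" "y \<in> \<hh> \<Longrightarrow> g y f = 0"
  "g e f = 0" "g f e = 0" "g f f = 1" "g e e = 1"
proof -
  have "g f e = - g e f" by (rule J_skew)
  then show "g e f = 0" "g f e = 0" using g_sym[of e f] by auto
qed (auto simp: e_perp f_perp e_unit J_orth g_sym[of y])

lemma endo_br: "endo (br x)" and endo_J: "endo J"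
  using ideal J_h linear_br linear_J by (auto simp: endo_def)

lemma ideal': "x \<in> \<hh> \<Longrightarrow> br x y \<in> \<hh>"
  using ideal[of x y] br_anti[of x y] h_closed(4) by simp

lemma decompose: obtains p q y where "x = p *\<^sub>R e + q *\<^sub>R f + y" "y \<in> \<hh>"
  using that[of "g x e" "g x f" "x - g x e *\<^sub>R e - g x f *\<^sub>R f"] split[of x] by simp

text \<open>
  With \<open>\<sigma>\<^sub>M(x, y) = g (M x) y - g x (M y)\<close> for \<open>M = J (ad k)\<close>, the torsion is \<open>c(x, f, y) = - \<sigma>(J x, J y)\<close>
  for \<open>k = e\<close> and \<open>c(x, e, y) = \<sigma>(J x, J y)\<close> for \<open>k = f\<close>, while \<open>c\<close> vanishes on \<open>\<hh>\<close>. So the only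
  information in \<open>dc = 0\<close> is in its values on \<open>(e, f, x, y)\<close>. Tracing this equation over \<open>y = J x\<close> produces
  \<open>tr (M M) - tr (M\<^sup>T M)\<close> for both \<open>k\<close>, that is, minus a sum of squares.
\<close>

lemma skt_imp_symplectic_action:
  assumes ef: "br e f \<in> \<hh>"
    and skt: "\<And>x y z w. ce_diff3 br (bismut_torsion br J g) x y z w = 0"
    and xy: "x \<in> \<hh>" "y \<in> \<hh>"
  shows "g (J (br e x)) y = g x (J (br e y))" "g (J (br f x)) y = g x (J (br f y))"
proof -
  let ?c = "bismut_torsion br J g"
  define M where "M k x = J (br k x)" for k x
  define s where "s k x y = g (M k x) y - g x (M k y)" for k x y
  have M: "endo (M k)" for k
    unfolding M_def by (rule endo_comp[OF endo_J endo_br])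
  have c_h: "?c x y z = 0" if "x \<in> \<hh>" "y \<in> \<hh>" "z \<in> \<hh>" for x y z
    using that by (simp add: bismut_torsion_def ce_diff2_def fundamental_form_def J_h abelian J_simps g_simps)
  have c_f: "?c x f y = - s e (J x) (J y)" if "x \<in> \<hh>" "y \<in> \<hh>" for x y
    using that br_anti[of e "J x"] g_sym[of "J (br e (J y))" "J x"]
    by (simp add: bismut_torsion_def ce_diff2_def fundamental_form_def J_h abelian J_simps
        g_simps br_simps s_def M_def)
  have c_e: "?c x e y = s f (J x) (J y)" if "x \<in> \<hh>" "y \<in> \<hh>" for x y
    using that br_anti[of f "J x"] g_sym[of "J (br f (J y))" "J x"]
    by (simp add: bismut_torsion_def ce_diff2_def fundamental_form_def J_h abelian J_simps
        g_simps br_simps s_def M_def)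
  have c_0: "?c 0 e f = 0"
    by (simp add: bismut_torsion_def ce_diff2_def fundamental_form_def J_simps g_simps br_simps)
  have s_anti: "s k y x = - s k x y" for k x y
    using g_sym[of y "M k x"] g_sym[of x "M k y"] by (simp add: s_def)
  have skt': "s e (M e x) (J y) + s e (J x) (M e y) + s f (M f x) (J y) + s f (J x) (M f y) = 0"
    if "x \<in> \<hh>" "y \<in> \<hh>" for x y
    using skt[of e f x y] that c_h[OF ef that] s_anti[of e "J x" "M e y"] s_anti[of f "J x" "M f y"]
    by (simp add: ce_diff3_def c_f c_e c_0 ideal abelian M_def)
  define Q where "Q k x y = s k (M k x) y" for k x y
  have linM: "linear (M k)" for k using M by (simp add: endo_def)
  have bilQ: "bilinear (Q k)" for k
    unfolding Q_def s_def bilinear_def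
    by (auto intro!: linearI simp: linear_add[OF linM] linear_scale[OF linM] g_simps algebra_simps)
  (* The choice y = J b makes the equation a sum of values of Q on the diagonal, at b and at J b;
     the two halves have the same trace. *)
  have "Q e b b + Q f b b + Q e (J b) (J b) + Q f (J b) (J b) = 0" if "b \<in> B" for b
    using skt'[of b "J b"] B_in_h[OF that] s_anti[of e "M e (J b)" "J b"] s_anti[of f "M f (J b)" "J b"]
    by (simp add: J_h JJ Q_def s_def g_simps linear_neg[OF linM])
  then have "(\<Sum>b\<in>B. Q e b b + Q f b b + Q e (J b) (J b) + Q f (J b) (J b)) = 0" by simp
  then have sum0: "(\<Sum>b\<in>B. Q e b b) + (\<Sum>b\<in>B. Q f b b) = 0"
    using trace_form_invariant[OF bilQ endo_J J_skew JJ, of e]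
      trace_form_invariant[OF bilQ endo_J J_skew JJ, of f]
    by (simp add: sum.distrib)
  have sumQ: "(\<Sum>b\<in>B. Q k b b) = - ((\<Sum>b\<in>B. \<Sum>c\<in>B. (g (M k b) c - g (M k c) b)\<^sup>2) / 2)" for k
    unfolding sum_square_defect[OF M, symmetric]
    by (simp add: Q_def s_def tr_def sum_subtractf)
  have defect0: "(\<Sum>b\<in>B. \<Sum>c\<in>B. (g (M k b) c - g (M k c) b)\<^sup>2) = 0" if "k = e \<or> k = f" for k
  proof -
    have "0 \<le> (\<Sum>b\<in>B. \<Sum>c\<in>B. (g (M k b) c - g (M k c) b)\<^sup>2)" for k
      by (intro sum_nonneg) auto
    from this[of e] this[of f] show ?thesis
      using sum0 that unfolding sumQ by auto
  qed
  have entries: "g (M k b) c = g (M k c) b" if "k = e \<or> k = f" "b \<in> B" "c \<in> B" for k b c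
  proof -
    have "(\<Sum>c\<in>B. (g (M k b) c - g (M k c) b)\<^sup>2) = 0"
      using defect0[OF that(1)] that(2) orthonormal_B
      by (subst (asm) sum_nonneg_eq_0_iff) (auto simp: orthonormal_def intro: sum_nonneg)
    then have "(g (M k b) c - g (M k c) b)\<^sup>2 = 0"
      using that(3) orthonormal_B
      by (subst (asm) sum_nonneg_eq_0_iff) (auto simp: orthonormal_def)
    then show ?thesis by simp
  qed
  have "g (M k x) y = g x (M k y)" if "k = e \<or> k = f" for k
    by (rule symmetric_if_no_defect[OF M _ xy]) (rule entries[OF that])
  then show "g (J (br e x)) y = g x (J (br e y))" "g (J (br f x)) y = g x (J (br f y))"
    unfolding M_def by blast+
qed

text \<open>
  An operator that is infinitesimally symplectic and commutes with \<open>J\<close> is skew, since \<open>\<omega> = g (J _) _\<close>.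
\<close>

lemma skt_imp_unitary_action:
  assumes ef: "br e f \<in> \<hh>"
    and skt: "\<And>x y z w. ce_diff3 br (bismut_torsion br J g) x y z w = 0"
    and xy: "x \<in> \<hh>" "y \<in> \<hh>"
  shows "g (br e x) y = - g x (br e y)" "g (br f x) y = - g x (br f y)"
proof -
  note sym = skt_imp_symplectic_action[OF ef skt]
  have comm: "br e (br f z) = br f (br e z)" if "z \<in> \<hh>" for z
    using br_commutator[of e f z] abelian[OF ef that] by simp
  have int: "br e z + J (br f z) + J (br e (J z)) - br f (J z) = 0" if "z \<in> \<hh>" for z
    using integrable_J[of e z] by (simp add: J_simps algebra_simps)
  have J_comm: "br e (J z) = J (br e z)" "br f (J z) = J (br f z)" if "z \<in> \<hh>" for z
    using commuting_with_complex_structure[OF endo_br endo_br endo_J J_skew JJ, of e f z]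
      sym(1) comm int that by blast+
  show "g (br e x) y = - g x (br e y)"
    using J_orth[of "br e x" y] sym(1)[OF xy(1) J_h[OF xy(2)]] J_comm[OF xy(2)]
    by (simp add: JJ g_simps)
  show "g (br f x) y = - g x (br f y)"
    using J_orth[of "br f x" y] sym(2)[OF xy(1) J_h[OF xy(2)]] J_comm[OF xy(2)]
    by (simp add: JJ g_simps)
qed

text \<open>
  The orthogonal complement \<open>K\<close> of \<open>\<hh>\<close> is a plane. If \<open>I e\<close> were in \<open>K\<close>, then \<open>I\<close> would preserve \<open>K\<close>, hence
  \<open>\<hh>\<close>. So the components \<open>u\<close>, \<open>w\<close> of \<open>I e\<close>, \<open>I f\<close> in \<open>\<hh>\<close> do not vanish, and \<open>I\<close> sends them back, up to the
  factor \<open>- \<beta>\<close> and a multiple of each other, to \<open>e\<close> and \<open>f\<close>. That is why integrability of \<open>I\<close>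
  on \<open>\<hh>\<close> controls both \<open>ad e\<close> and \<open>ad f\<close>.
\<close>

lemma transverse_complex_structure_imp_commuting:
  assumes ef: "br e f \<in> \<hh>"
    and skew_e: "\<And>x y. x \<in> \<hh> \<Longrightarrow> y \<in> \<hh> \<Longrightarrow> g (br e x) y = - g x (br e y)"
    and skew_f: "\<And>x y. x \<in> \<hh> \<Longrightarrow> y \<in> \<hh> \<Longrightarrow> g (br f x) y = - g x (br f y)"
    and I: "complex_structure br I" "compatible g I" and Ih: "I ` \<hh> \<noteq> \<hh>"
  shows "br e f = 0"
proof -
  have linI: "linear I" and II: "\<And>x. I (I x) = - x"
    and int: "\<And>x y. br x y + I (br (I x) y + br x (I y)) - br (I x) (I y) = 0"
    using I(1) by (auto simp: complex_structure_def)
  note I_simps = linear_add[OF linI] linear_diff[OF linI] linear_neg[OF linI]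
    linear_scale[OF linI] linear_0[OF linI] II
  have I_orth: "g (I x) (I y) = g x y" for x y using I(2) by (simp add: compatible_def)
  have I_skew: "g (I x) y = - g x (I y)" for x y
    using I_orth[of x "I y"] by (simp add: II g_simps)
  have I_self: "g (I x) x = 0" for x using I_skew[of x x] g_sym[of x "I x"] by simp
  define \<alpha> where "\<alpha> = g (I e) f"
  define u where "u = I e - \<alpha> *\<^sub>R f"
  define w where "w = I f + \<alpha> *\<^sub>R e"
  define \<beta> where "\<beta> = 1 - \<alpha>\<^sup>2"
  have If_e: "g (I f) e = - \<alpha>" using I_skew[of f e] g_sym[of f "I e"] by (simp add: \<alpha>_def)
  have u: "u \<in> \<hh>" using split[of "I e"] I_self[of e] by (simp add: u_def \<alpha>_def)
  have w: "w \<in> \<hh>" using split[of "I f"] I_self[of f] If_e by (simp add: w_def)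
  have Ie: "I e = u + \<alpha> *\<^sub>R f" and If: "I f = w - \<alpha> *\<^sub>R e" by (simp_all add: u_def w_def)
  have uu: "g u u = \<beta>"
    using I_orth[of e e] unfolding Ie by (simp add: g_simps perp u \<beta>_def power2_eq_square)
  have ww: "g w w = \<beta>"
    using I_orth[of f f] unfolding If by (simp add: g_simps perp w \<beta>_def power2_eq_square)
  have uw: "g u w = 0" "g w u = 0"
    using I_orth[of e f] g_sym[of u w] unfolding Ie If by (simp_all add: g_simps perp u w)
  have Iu: "I u = - \<beta> *\<^sub>R e - \<alpha> *\<^sub>R w"
    by (simp add: u_def I_simps If \<beta>_def power2_eq_square algebra_simps)
  have Iw: "I w = - \<beta> *\<^sub>R f + \<alpha> *\<^sub>R u"
    by (simp add: w_def I_simps Ie \<beta>_def power2_eq_square algebra_simps)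
  (* The conditions g y u = 0 and g y w = 0 describe the intersection of the ideal with its image
     under I. *)
  have I_mem: "I y \<in> \<hh>" if "y \<in> \<hh>" "g y u = 0" "g y w = 0" for y
  proof -
    have "g (I y) e = 0" "g (I y) f = 0"
      using I_skew[of y e] I_skew[of y f] that by (simp_all add: Ie If g_simps perp)
    then show ?thesis using split[of "I y"] by simp
  qed
  have I_perp: "g y u = 0" "g y w = 0" if "y \<in> \<hh>" "I y \<in> \<hh>" for y
    using I_skew[of y e] I_skew[of y f] that by (simp_all add: Ie If g_simps perp)
  have \<beta>: "\<beta> \<noteq> 0"
  proof
    assume "\<beta> = 0"
    then have "u = 0" "w = 0" using uu ww g_self_eq_0 by auto
    then have "\<And>y. y \<in> \<hh> \<Longrightarrow> I y \<in> \<hh>" using I_mem by (simp add: g_simps)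
    then have "I ` \<hh> = \<hh>"
      using h_closed(4) by (auto simp: image_iff) (metis II minus_minus)
    then show False using Ih by simp
  qed
  (* Integrability on (u, y) and (w, y): only the components of I u and I w along e and f act,
     so ad e and ad f commute with I on the intersection. *)
  have stable: "g (br k y) u = 0 \<and> g (br k y) w = 0"
    if y: "y \<in> \<hh>" "g y u = 0" "g y w = 0" and k: "k = e \<or> k = f" for k y
  proof -
    have Iy: "I y \<in> \<hh>" using I_mem y by blast
    have "\<beta> *\<^sub>R I (br e y) = \<beta> *\<^sub>R br e (I y)"
      using int[of u y] by (auto simp: Iu br_simps I_simps abelian u w y Iy)
    moreover have "\<beta> *\<^sub>R I (br f y) = \<beta> *\<^sub>R br f (I y)"
      using int[of w y] by (auto simp: Iw br_simps I_simps abelian u w y Iy)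
    ultimately have "I (br k y) \<in> \<hh>" using k \<beta> ideal[OF Iy] by auto
    then show ?thesis using I_perp ideal y by blast
  qed
  have rotation: "z = (g z u / \<beta>) *\<^sub>R u + (g z w / \<beta>) *\<^sub>R w"
    if z: "z \<in> \<hh>" and zperp: "\<And>y. y \<in> \<hh> \<Longrightarrow> g y u = 0 \<Longrightarrow> g y w = 0 \<Longrightarrow> g z y = 0" for z
  proof -
    define y where "y = z - ((g z u / \<beta>) *\<^sub>R u + (g z w / \<beta>) *\<^sub>R w)"
    have y: "y \<in> \<hh>" using z u w by (simp add: y_def h_closed)
    have yuw: "g y u = 0" "g y w = 0" using \<beta> by (simp_all add: y_def g_simps uu ww uw)
    have "g y y = g z y - (g z u / \<beta>) * g u y - (g z w / \<beta>) * g w y"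
      by (subst (1) y_def) (simp add: g_simps)
    also have "\<dots> = 0" using zperp[OF y yuw] yuw g_sym[of u y] g_sym[of w y] by simp
    finally show ?thesis by (simp add: g_self_eq_0 y_def)
  qed
  have act: "br k u = (g (br k u) w / \<beta>) *\<^sub>R w" "br k w = - (g (br k u) w / \<beta>) *\<^sub>R u"
    if k: "k = e \<or> k = f" for k
  proof -
    have skew: "g (br k x) y = - g x (br k y)" if "x \<in> \<hh>" "y \<in> \<hh>" for x y
      using that skew_e skew_f k by blast
    have self: "g (br k x) x = 0" if "x \<in> \<hh>" for x
      using skew[OF that that] g_sym[of x "br k x"] by simp
    have "g (br k u) y = 0 \<and> g (br k w) y = 0" if "y \<in> \<hh>" "g y u = 0" "g y w = 0" for y
      using stable[OF that k] skew[OF u that(1)] skew[OF w that(1)]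
        g_sym[of u "br k y"] g_sym[of w "br k y"] by simp
    then have "br k u = (g (br k u) u / \<beta>) *\<^sub>R u + (g (br k u) w / \<beta>) *\<^sub>R w"
      "br k w = (g (br k w) u / \<beta>) *\<^sub>R u + (g (br k w) w / \<beta>) *\<^sub>R w"
      using rotation[OF ideal[OF u]] rotation[OF ideal[OF w]] by blast+
    moreover have "g (br k w) u = - g (br k u) w"
      using skew[OF w u] g_sym[of w "br k u"] by simp
    ultimately show "br k u = (g (br k u) w / \<beta>) *\<^sub>R w" "br k w = - (g (br k u) w / \<beta>) *\<^sub>R u"
      using self[OF u] self[OF w] by simp_all
  qed
  obtain a b where ab: "br e u = a *\<^sub>R w" "br e w = - a *\<^sub>R u" "br f u = b *\<^sub>R w" "br f w = - b *\<^sub>R u"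
    using act by blast
  have int_uw: "I (br (I u) w + br u (I w)) = br (I u) (I w)"
    using int[of u w] by (simp add: abelian u w)
  have lhs: "br (I u) w + br u (I w) = (\<beta> * a) *\<^sub>R u + (\<beta> * b) *\<^sub>R w"
    by (simp add: Iu Iw br_simps ab br_self br_anti[of u f] abelian[OF w w] abelian[OF u u])
  have rhs: "br (I u) (I w) = \<beta>\<^sup>2 *\<^sub>R br e f - (\<alpha> * \<beta> * a) *\<^sub>R w + (\<alpha> * \<beta> * b) *\<^sub>R u"
    by (simp add: Iu Iw br_simps ab br_anti[of w f] abelian[OF w u] power2_eq_square algebra_simps)
  (* The terms containing alpha cancel. *)
  have "\<beta>\<^sup>2 *\<^sub>R (br e f + a *\<^sub>R e + b *\<^sub>R f) = 0"
    using int_uw unfolding lhs rhs by (simp add: I_simps Iu Iw power2_eq_square algebra_simps)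
  then have ef_eq: "br e f + a *\<^sub>R e + b *\<^sub>R f = 0" using \<beta> by simp
  have "g (br e f + a *\<^sub>R e + b *\<^sub>R f) e = a" "g (br e f + a *\<^sub>R e + b *\<^sub>R f) f = b"
    by (simp_all add: g_simps perp ef)
  then have "a = 0" "b = 0" unfolding ef_eq by (simp_all add: g_simps)
  then show ?thesis using ef_eq by simp
qed

text \<open>
  When \<open>e\<close> and \<open>f\<close> commute, \<open>\<omega>([x, y], z)\<close> is built from the forms \<open>\<omega>([k, y], z)\<close> with \<open>k\<close> orthogonal to \<open>\<hh>\<close>
  and \<open>y, z \<in> \<hh>\<close>. These are symmetric in \<open>y\<close> and \<open>z\<close>, so they cancel in the alternating sum \<open>d\<omega>\<close>.
\<close>

lemma kaehler_if_symplectic_action: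
  assumes ef: "br e f = 0"
    and sym_e: "\<And>x y. x \<in> \<hh> \<Longrightarrow> y \<in> \<hh> \<Longrightarrow> g (J (br e x)) y = g x (J (br e y))"
    and sym_f: "\<And>x y. x \<in> \<hh> \<Longrightarrow> y \<in> \<hh> \<Longrightarrow> g (J (br f x)) y = g x (J (br f y))"
  shows "kaehler_structure br J g"
proof -
  have "ce_diff2 br (fundamental_form J g) x1 x2 x3 = 0" for x1 x2 x3
  proof -
    obtain p1 q1 y1 where 1: "x1 = p1 *\<^sub>R e + q1 *\<^sub>R f + y1" "y1 \<in> \<hh>" by (rule decompose)
    obtain p2 q2 y2 where 2: "x2 = p2 *\<^sub>R e + q2 *\<^sub>R f + y2" "y2 \<in> \<hh>" by (rule decompose)
    obtain p3 q3 y3 where 3: "x3 = p3 *\<^sub>R e + q3 *\<^sub>R f + y3" "y3 \<in> \<hh>" by (rule decompose)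
    have br: "br (p *\<^sub>R e + q *\<^sub>R f + y) (p' *\<^sub>R e + q' *\<^sub>R f + y') =
        p *\<^sub>R br e y' + q *\<^sub>R br f y' - p' *\<^sub>R br e y - q' *\<^sub>R br f y"
      if "y \<in> \<hh>" "y' \<in> \<hh>" for p q y p' q' y'
      by (simp add: br_simps br_self ef br_anti[of f e] abelian that br_anti[of y e]
          br_anti[of y f] algebra_simps)
    have sym: "g (J (br e y)) y' = g (J (br e y')) y" "g (J (br f y)) y' = g (J (br f y')) y"
      if "y \<in> \<hh>" "y' \<in> \<hh>" for y y'
      using sym_e[OF that] sym_f[OF that] g_sym[of y] by simp_all
    have in_h: "J (br k y) \<in> \<hh>" if "y \<in> \<hh>" for k y using that ideal J_h by blast
    show ?thesis
      unfolding ce_diff2_def fundamental_form_def 1(1) 2(1) 3(1)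
        br[OF 1(2) 2(2)] br[OF 1(2) 3(2)] br[OF 2(2) 3(2)]
      using sym[OF 1(2) 2(2)] sym[OF 1(2) 3(2)] sym[OF 2(2) 3(2)]
      by (simp add: 1 2 3 J_simps g_simps perp in_h algebra_simps)
  qed
  then show ?thesis
    using inner_product_g complex_J compatible_J
    by (simp add: kaehler_structure_def hermitian_structure_def)
qed

lemma br_mod_h: "\<exists>t. br x y - t *\<^sub>R br e f \<in> \<hh>"
proof -
  obtain p q z where 1: "x = p *\<^sub>R e + q *\<^sub>R f + z" "z \<in> \<hh>" by (rule decompose)
  obtain p' q' z' where 2: "y = p' *\<^sub>R e + q' *\<^sub>R f + z'" "z' \<in> \<hh>" by (rule decompose)
  have "br x y - (p * q' - q * p') *\<^sub>R br e f =
      p *\<^sub>R br e z' + q *\<^sub>R br f z' + p' *\<^sub>R br z e + q' *\<^sub>R br z f + br z z'"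
    unfolding 1 2 by (simp add: br_simps br_self br_anti[of f e] algebra_simps)
  also have "\<dots> \<in> \<hh>" using 1 2 by (intro h_closed ideal ideal') auto
  finally show ?thesis by blast
qed

text \<open>
  If \<open>[e, f]\<close> has a nonzero part \<open>F = p e + q f\<close> outside \<open>\<hh>\<close>, then a vector \<open>E\<close> in the plane of \<open>e\<close> and \<open>f\<close>,
  orthogonal to \<open>F\<close> and suitably scaled, satisfies \<open>[E, F] = [e, f] = F\<close> modulo \<open>\<hh>\<close>.
\<close>

lemma commutator_in_nilradical:
  assumes "is_nilradical br \<hh>" "lie_abelian br \<hh>"
  shows "br e f \<in> \<hh>"
proof -
  obtain p q v where pq: "br e f = p *\<^sub>R e + q *\<^sub>R f + v" "v \<in> \<hh>" by (rule decompose)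
  define F where "F = p *\<^sub>R e + q *\<^sub>R f"
  have ef: "br e f = F + v" using pq by (simp add: F_def)
  show ?thesis
  proof (cases "p\<^sup>2 + q\<^sup>2 = 0")
    case True
    then have "p = 0" "q = 0" by (auto simp: sum_power2_eq_zero_iff)
    then show ?thesis using pq by simp
  next
    case False
    define E where "E = (1 / (p\<^sup>2 + q\<^sup>2)) *\<^sub>R (q *\<^sub>R e - p *\<^sub>R f)"
    have "br (q *\<^sub>R e - p *\<^sub>R f) F = (p\<^sup>2 + q\<^sup>2) *\<^sub>R br e f"
      by (simp add: F_def br_simps br_self br_anti[of f e] power2_eq_square algebra_simps)
    then have "br E F = F + v"
      unfolding E_def bilinear_lmul[OF bilinear_br] using False ef by (simp del: sum_power2_eq_zero_iff)
    then have EF: "br E F - F \<in> \<hh>" using pq by simp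
    have "\<exists>t. br x y - t *\<^sub>R F \<in> \<hh>" for x y
    proof -
      obtain t where "br x y - t *\<^sub>R br e f \<in> \<hh>" using br_mod_h by blast
      then have "br x y - t *\<^sub>R br e f + t *\<^sub>R v \<in> \<hh>"
        using h_closed(2)[OF _ h_closed(5)[OF pq(2)]] by blast
      then have "br x y - t *\<^sub>R F \<in> \<hh>" by (simp add: ef algebra_simps)
      then show ?thesis by blast
    qed
    then have "F \<in> \<hh>" using mem_abelian_nilradical[OF assms _ EF] by blast
    then show ?thesis using ef pq h_closed(2) by simp
  qed
qed

end

section \<open>The effect of a second complex structure\<close>

text \<open>
  The codimension enters through the splitting: an orthonormal basis of \<open>\<hh>\<close> together with \<open>e\<close> and \<open>J e\<close> has
  as many elements as the dimension of the algebra, hence spans it.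
\<close>

lemma skt_with_transverse_complex_structure_imp_kaehler:
  fixes br :: "'a::euclidean_space \<Rightarrow> 'a \<Rightarrow> 'a" and \<hh> :: "'a set"
  assumes lie: "lie_algebra br" and nil: "is_nilradical br \<hh>" and ab: "lie_abelian br \<hh>"
    and codim: "dim \<hh> + 2 = DIM('a)"
    and skt: "skt_structure br J g" and Jh: "J ` \<hh> = \<hh>"
    and I: "complex_structure br I" "compatible g I" and Ih: "I ` \<hh> \<noteq> \<hh>"
  shows "kaehler_structure br J g"
proof -
  have J: "inner_product g" "complex_structure br J" "compatible g J"
    and closed: "\<And>x y z w. ce_diff3 br (bismut_torsion br J g) x y z w = 0"
    using skt by (auto simp: skt_structure_def hermitian_structure_def)
  interpret positive_form g by unfold_locales (rule J)
  have sub: "subspace \<hh>" and ideal: "\<And>x y. y \<in> \<hh> \<Longrightarrow> br x y \<in> \<hh>"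
    using nil by (auto simp: is_nilradical_def nilpotent_ideal_def lie_ideal_def)
  obtain B where B: "orthonormal B" "span B = \<hh>" using orthonormal_basis_exists[OF sub] .
  have B_h: "B \<subseteq> \<hh>" using B(2) span_superset by blast
  have "span B \<noteq> UNIV" using codim B(2) by auto
  then obtain x where "x \<notin> span B" by blast
  then obtain e where e: "g e e = 1" "\<And>y. y \<in> span B \<Longrightarrow> g e y = 0"
    using unit_normal_vector[OF B(1) subspace_UNIV, of x] by blast
  have J_h: "J y \<in> \<hh>" if "y \<in> \<hh>" for y using Jh that by blast
  have JJ: "J (J y) = - y" and Jg: "g (J y) (J z) = g y z" for y z
    using J by (auto simp: complex_structure_def compatible_def)
  have J_skew: "g (J y) z = - g y (J z)" for y z
    using Jg[of y "J z"] by (simp add: JJ g_simps)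
  have Je: "g (J e) (J e) = 1" "g (J e) e = 0" "\<And>y. y \<in> \<hh> \<Longrightarrow> g (J e) y = 0"
    using J_skew[of e] g_sym[of e "J e"] Jg e J_h B(2) by auto
  have C1: "orthonormal (insert e B)" "e \<notin> B"
    using orthonormal_insert[OF B(1) e(1)] e(2) span_base by blast+
  have C2: "orthonormal (insert (J e) (insert e B))" "J e \<notin> insert e B"
    using orthonormal_insert[OF C1(1) Je(1)] Je(2,3) B_h by blast+
  let ?C = "insert (J e) (insert e B)"
  have finB: "finite B" using B(1) by (simp add: orthonormal_def)
  have "card B = dim \<hh>"
    using dim_eq_card_independent[OF orthonormal_independent[OF B(1)]] B(2) dim_span[of B] by simp
  then have "card ?C = DIM('a)" using C1(2) C2(2) finB codim by simp
  then have span_C: "span ?C = UNIV"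
    using card_ge_dim_independent[OF subset_UNIV orthonormal_independent[OF C2(1)]] by auto
  have split: "x - g x e *\<^sub>R e - g x (J e) *\<^sub>R J e \<in> \<hh>" for x
  proof -
    have "x = (\<Sum>b\<in>?C. g x b *\<^sub>R b)"
      using orthonormal_expansion[OF C2(1)] span_C by simp
    then have "x - g x e *\<^sub>R e - g x (J e) *\<^sub>R J e = (\<Sum>b\<in>B. g x b *\<^sub>R b)"
      using C1(2) C2(2) finB by (simp add: algebra_simps)
    also have "\<dots> \<in> \<hh>" using B_h sub by (intro subspace_sum subspace_scale) auto
    finally show ?thesis .
  qed
  interpret hermitian_abelian_ideal br g \<hh> B J e
    by unfold_locales
      (use lie B J ideal J_h e split ab in \<open>auto simp: lie_abelian_def\<close>)
  have ef: "br e (J e) \<in> \<hh>" by (rule commutator_in_nilradical[OF nil ab])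
  have "br e (J e) = 0"
    using transverse_complex_structure_imp_commuting[OF ef _ _ I Ih]
      skt_imp_unitary_action[OF ef closed] by blast
  then show ?thesis
    using kaehler_if_symplectic_action skt_imp_symplectic_action[OF ef closed] by blast
qed

theorem proposition3p2:
  fixes br :: "'a::euclidean_space \<Rightarrow> 'a \<Rightarrow> 'a"
    and \<hh> :: "'a set"
    and n :: nat
  assumes "lie_algebra br"
    and "lie_solvable br"
    and "DIM('a) = 2 * n"
    and "2 * n > 4"
    and "is_nilradical br \<hh>"
    and "lie_abelian br \<hh>"
    and "dim \<hh> + 2 = DIM('a)"
  shows "(\<forall>J g. skt_structure br J g \<and> J ` \<hh> = \<hh> \<and>
              (\<exists>I. complex_structure br I \<and> compatible g I \<and> I ` \<hh> \<noteq> \<hh>)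
            \<longrightarrow> kaehler_structure br J g) \<and>
         \<not> (\<exists>I J g. non_kaehler_generalized_kaehler br I J g \<and> I ` \<hh> \<noteq> \<hh> \<and> J ` \<hh> = \<hh>)"
proof (intro conjI allI impI notI)
  note main = skt_with_transverse_complex_structure_imp_kaehler[OF assms(1,5,6,7)]
  fix J g
  assume "skt_structure br J g \<and> J ` \<hh> = \<hh> \<and>
    (\<exists>I. complex_structure br I \<and> compatible g I \<and> I ` \<hh> \<noteq> \<hh>)"
  then show "kaehler_structure br J g" using main by blast
next
  note main = skt_with_transverse_complex_structure_imp_kaehler[OF assms(1,5,6,7)]
  assume "\<exists>I J g. non_kaehler_generalized_kaehler br I J g \<and> I ` \<hh> \<noteq> \<hh> \<and> J ` \<hh> = \<hh>"
  then obtain I J g where gk: "generalized_kaehler br I J g"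
    and nz: "\<exists>x y z. bismut_torsion br I g x y z \<noteq> 0"
    and h: "I ` \<hh> \<noteq> \<hh>" "J ` \<hh> = \<hh>"
    unfolding non_kaehler_generalized_kaehler_def by blast
  have opp: "bismut_torsion br J g x y z = - bismut_torsion br I g x y z" for x y z
    using gk by (simp add: generalized_kaehler_def)
  have "ce_diff3 br (bismut_torsion br J g) x y z w =
      - ce_diff3 br (bismut_torsion br I g) x y z w" for x y z w
    by (simp add: ce_diff3_def opp)
  then have "skt_structure br J g"
    using gk by (simp add: skt_structure_def generalized_kaehler_def)
  then have "kaehler_structure br J g"
    using main h gk unfolding generalized_kaehler_def hermitian_structure_def by blast
  then have "bismut_torsion br J g x y z = 0" for x y z
    by (simp add: bismut_torsion_def kaehler_structure_def)
  then show False using nz opp by simp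
qed

end
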